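(* The following are immersions into $\mathbb{L}^3$ and $\mathbb{R}^3_2$ whose induced metrics (pullbacks of $\langle\cdot,\cdot\rangle_1$ and $\langle\cdot,\cdot\rangle_2$ respectively) are the indicated metrics of constant Gaussian curvature $K$. (a) $K=0$, metrics $ds^2=-du^2+dv^2$ and $ds^2=d\tau^2-d\vartheta^2$: the immersions are trivially given by inclusions as coordinate planes. (b) $K=1$. For $ds^2=-du^2+\cosh^2u\,dv^2$: (i) $\mathbf{x}\colon\mathbb{R}^2\to\mathbb{S}^2_1\subseteq\mathbb{L}^3$, $\mathbf{x}(u,v)=(\cosh u\cos v,\cosh u\sin v,\sinh u)$; (ii) $\mathbf{x}\colon\cosh^{-1}\big(]1,\sqrt2[\big)\times\mathbb{R}\to\mathbb{R}^3_2$, $\mathbf{x}(u,v)=\left(\cosh u\sinh v,\cosh u\cosh v,\int_0^u\sqrt{2-\cosh^2t}\,dt\right)$. For $ds^2=d\tau^2-\cos^2\tau\,d\vartheta^2$: (i) $\mathbf{x}\colon\mathbb{R}^2\to\mathbb{S}^2_1\subseteq\mathbb{L}^3$, $\mathbf{x}(\tau,\vartheta)=(\sin\tau,\cos\tau\cosh\vartheta,\cos\tau\sinh\vartheta)$; (ii) $\mathbf{x}\colon\left]-\frac{\pi}{2},\frac{\pi}{2}\right[\times\mathbb{R}\to\mathbb{R}^3_2$, $\mathbf{x}(\tau,\vartheta)=\left(\int_0^\tau\sqrt{1+\sin^2t}\,dt,\cos\tau\cos\vartheta,\cos\tau\sin\vartheta\right)$. (c) $K=-1$. For $ds^2=-du^2+\cos^2u\,dv^2$: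 (i) $\mathbf{x}\colon\left]-\frac{\pi}{2},\frac{\pi}{2}\right[\times\mathbb{R}\to\mathbb{L}^3$, $\mathbf{x}(u,v)=\left(\cos u\cos v,\cos u\sin v,\int_0^u\sqrt{1+\sin^2t}\,dt\right)$; (ii) $\mathbf{x}\colon\mathbb{R}^2\to\mathbb{H}^2_1\subseteq\mathbb{R}^3_2$, $\mathbf{x}(u,v)=(\cos u\sinh v,\cos u\cosh v,\sin u)$. For $ds^2=d\tau^2-\cosh^2\tau\,d\vartheta^2$: (i) $\mathbf{x}\colon\cosh^{-1}\big(]1,\sqrt2[\big)\times\mathbb{R}\to\mathbb{L}^3$, $\mathbf{x}(\tau,\vartheta)=\left(\int_0^\tau\sqrt{2-\cosh^2t}\,dt,\cosh\tau\cosh\vartheta,\cosh\tau\sinh\vartheta\right)$; (ii) $\mathbf{x}\colon\mathbb{R}^2\to\mathbb{H}^2_1\subseteq\mathbb{R}^3_2$, $\mathbf{x}(\tau,\vartheta)=(\sinh\tau,\cosh\tau\cos\vartheta,\cosh\tau\sin\vartheta)$.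
   Context: For $x,y\in\mathbb{R}^3$, $\langle x,y\rangle_1=x^1y^1+x^2y^2-x^3y^3$ and $\langle x,y\rangle_2=x^1y^1-x^2y^2-x^3y^3$. $\mathbb{L}^3=\mathbb{R}^3_1=(\mathbb{R}^3,\langle\cdot,\cdot\rangle_1)$ is Lorentz-Minkowski space and $\mathbb{R}^3_2=(\mathbb{R}^3,\langle\cdot,\cdot\rangle_2)$. The de Sitter space is $\mathbb{S}^2_1=\{x\in\mathbb{L}^3:\langle x,x\rangle_1=1\}$ and the anti-de Sitter space is $\mathbb{H}^2_1=\{x\in\mathbb{R}^3_2:\langle x,x\rangle_2=-1\}$. $]a,b[$ denotes an open interval, and $\cosh^{-1}(]1,\sqrt2[)$ is the inverse image of $]1,\sqrt2[$ under $\cosh$. The letter $K$ denotes the Gaussian curvature of the listed metrics.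
   Formalization: The maps in (b), second metric, (i) and (c), first metric, (ii) are not immersions where the cosine vanishes; immersion and the curvature of these two metrics are claimed only where it is nonzero, while smoothness, the pullback formula and the image hold on all of the plane. *)

theory Defs
  imports "HOL-Analysis.Analysis"
begin

definition lorentz_form :: "real^3 \<Rightarrow> real^3 \<Rightarrow> real" where
  "lorentz_form x y = x$1 * y$1 + x$2 * y$2 - x$3 * y$3"

definition index2_form :: "real^3 \<Rightarrow> real^3 \<Rightarrow> real" where
  "index2_form x y = x$1 * y$1 - x$2 * y$2 - x$3 * y$3"

definition de_Sitter :: "(real^3) set" where
  "de_Sitter = {x. lorentz_form x x = 1}"

definition anti_de_Sitter :: "(real^3) set" where
  "anti_de_Sitter = {x. index2_form x x = -1}"

text \<open>\<open>C_diff_on n U f\<close> says that \<open>f\<close> is of class \<open>C\<^sup>n\<close> on \<open>U\<close>; it is meant for open \<open>U\<close>, since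
  derivatives are taken in the whole space.\<close>

primrec C_diff_on ::
  "nat \<Rightarrow> 'a::real_normed_vector set \<Rightarrow> ('a \<Rightarrow> 'b::real_normed_vector) \<Rightarrow> bool" where
  "C_diff_on 0 U f \<longleftrightarrow> continuous_on U f"
| "C_diff_on (Suc n) U f \<longleftrightarrow>
     (\<forall>p\<in>U. f differentiable (at p)) \<and>
     (\<forall>X. C_diff_on n U (\<lambda>p. frechet_derivative f (at p) X))"

definition smooth_on ::
  "'a::real_normed_vector set \<Rightarrow> ('a \<Rightarrow> 'b::real_normed_vector) \<Rightarrow> bool" where
  "smooth_on U f \<longleftrightarrow> (\<forall>n. C_diff_on n U f)"

definition immersion_on ::
  "'a::real_normed_vector set \<Rightarrow> ('a \<Rightarrow> 'b::real_normed_vector) \<Rightarrow> bool" where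
  "immersion_on U f \<longleftrightarrow>
     open U \<and> smooth_on U f \<and> (\<forall>p\<in>U. inj (frechet_derivative f (at p)))"

text \<open>A field of bilinear forms on (a subset of) the parameter plane assigns to a point and two tangent
  vectors a real number.\<close>

type_synonym form_field = "real^2 \<Rightarrow> real^2 \<Rightarrow> real^2 \<Rightarrow> real"

definition pullback_form ::
  "(real^3 \<Rightarrow> real^3 \<Rightarrow> real) \<Rightarrow> (real^2 \<Rightarrow> real^3) \<Rightarrow> form_field" where
  "pullback_form B f p X Y =
     B (frechet_derivative f (at p) X) (frechet_derivative f (at p) Y)"

definition isometric_immersion_on ::
  "(real^2) set \<Rightarrow> form_field \<Rightarrow> (real^3 \<Rightarrow> real^3 \<Rightarrow> real) \<Rightarrow> (real^2 \<Rightarrow> real^3) \<Rightarrow> bool" where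
  "isometric_immersion_on U g B f \<longleftrightarrow>
     immersion_on U f \<and> (\<forall>p\<in>U. pullback_form B f p = g p)"

text \<open>The metric \<open>ds\<^sup>2 = E du\<^sup>2 + G dv\<^sup>2\<close>, as a field of bilinear forms.\<close>

definition diag_metric ::
  "(real \<Rightarrow> real \<Rightarrow> real) \<Rightarrow> (real \<Rightarrow> real \<Rightarrow> real) \<Rightarrow> form_field" where
  "diag_metric E G p X Y =
     E (p$1) (p$2) * X$1 * Y$1 + G (p$1) (p$2) * X$2 * Y$2"

definition param :: "(real \<Rightarrow> real \<Rightarrow> real^3) \<Rightarrow> real^2 \<Rightarrow> real^3" where
  "param x p = x (p$1) (p$2)"

definition pseudo_Riemannian_metric_on :: "(real^2) set \<Rightarrow> form_field \<Rightarrow> bool" where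
  "pseudo_Riemannian_metric_on U g \<longleftrightarrow>
     open U \<and> (\<forall>X Y. smooth_on U (\<lambda>p. g p X Y)) \<and>
     (\<forall>p\<in>U. bilinear (g p) \<and> (\<forall>X Y. g p X Y = g p Y X) \<and>
        (\<forall>X. (\<forall>Y. g p X Y = 0) \<longrightarrow> X = 0))"

definition partial_deriv :: "2 \<Rightarrow> (real^2 \<Rightarrow> real) \<Rightarrow> real^2 \<Rightarrow> real" where
  "partial_deriv i f p = frechet_derivative f (at p) (axis i 1)"

definition metric_matrix :: "form_field \<Rightarrow> real^2 \<Rightarrow> real^2^2" where
  "metric_matrix g p = (\<chi> i j. g p (axis i 1) (axis j 1))"

text \<open>\<open>christoffel g k i j\<close> is the symbol \<open>\<Gamma>\<^sup>k\<^sub>i\<^sub>j\<close> of the Levi-Civita connection, and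
  \<open>riemann g l k i j\<close> is the \<open>l\<close>-th component of \<open>R(\<partial>\<^sub>i, \<partial>\<^sub>j)\<partial>\<^sub>k\<close>, where
  \<open>R(X, Y) = [\<nabla>\<^sub>X, \<nabla>\<^sub>Y] - \<nabla>\<^bsub>[X, Y]\<^esub>\<close>.\<close>

definition christoffel :: "form_field \<Rightarrow> 2 \<Rightarrow> 2 \<Rightarrow> 2 \<Rightarrow> real^2 \<Rightarrow> real" where
  "christoffel g k i j p =
     (\<Sum>l\<in>UNIV. matrix_inv (metric_matrix g p) $ k $ l *
        (partial_deriv i (\<lambda>q. metric_matrix g q $ j $ l) p
         + partial_deriv j (\<lambda>q. metric_matrix g q $ i $ l) p
         - partial_deriv l (\<lambda>q. metric_matrix g q $ i $ j) p)) / 2"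

definition riemann :: "form_field \<Rightarrow> 2 \<Rightarrow> 2 \<Rightarrow> 2 \<Rightarrow> 2 \<Rightarrow> real^2 \<Rightarrow> real" where
  "riemann g l k i j p =
     partial_deriv i (christoffel g l j k) p - partial_deriv j (christoffel g l i k) p
     + (\<Sum>m\<in>UNIV. christoffel g l i m p * christoffel g m j k p
                  - christoffel g l j m p * christoffel g m i k p)"

text \<open>The sectional curvature
  \<open>g(R(\<partial>\<^sub>1, \<partial>\<^sub>2)\<partial>\<^sub>2, \<partial>\<^sub>1) / (g(\<partial>\<^sub>1, \<partial>\<^sub>1) g(\<partial>\<^sub>2, \<partial>\<^sub>2) - g(\<partial>\<^sub>1, \<partial>\<^sub>2)\<^sup>2)\<close>
  of the tangent plane. With this normalisation the de Sitter space has curvature 1.\<close>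

definition gaussian_curvature :: "form_field \<Rightarrow> real^2 \<Rightarrow> real" where
  "gaussian_curvature g p =
     (\<Sum>l\<in>UNIV. riemann g l 2 1 2 p * metric_matrix g p $ l $ 1) / det (metric_matrix g p)"

definition constant_curvature_metric_on :: "(real^2) set \<Rightarrow> form_field \<Rightarrow> real \<Rightarrow> bool" where
  "constant_curvature_metric_on U g K \<longleftrightarrow>
     pseudo_Riemannian_metric_on U g \<and> (\<forall>p\<in>U. gaussian_curvature g p = K)"

text \<open>The forms \<open>d\<tau>\<^sup>2 - cos\<^sup>2 \<tau> d\<theta>\<^sup>2\<close> and \<open>-du\<^sup>2 + cos\<^sup>2 u dv\<^sup>2\<close> degenerate on the lines where the
  cosine vanishes. The standard parametrisations of the de Sitter and anti-de Sitter spaces inducing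
  them are defined on the whole plane, but their second partial derivative vanishes on those lines,
  so \<open>cos_nonzero\<close> is the exact set on which the forms are metrics and these maps are immersions.\<close>

definition cos_nonzero :: "(real^2) set" where
  "cos_nonzero = {p. cos (p$1) \<noteq> 0}"

definition cosh_domain :: "(real^2) set" where
  "cosh_domain = {p. p$1 \<in> cosh -` {1<..<sqrt 2}}"

definition cos_strip :: "(real^2) set" where
  "cos_strip = {p. p$1 \<in> {-pi/2<..<pi/2}}"

end

theory Submission
  imports Defs
begin

text \<open>All metrics in question have the form \<open>e du\<^sup>2 + c f(u)\<^sup>2 dv\<^sup>2\<close> with constants \<open>e\<close> and
  \<open>c\<close>, and the curvature of such a metric is \<open>- f'' / (e f)\<close>
  (lemma \<open>gaussian_curvature_warped\<close>). It is therefore constantly \<open>K\<close> as soon as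
  \<open>f'' = - K e f\<close>, which holds for \<open>f = 1\<close>, \<open>f = cosh\<close> and \<open>f = cos\<close> with the respective signs.

  All curved maps are surfaces of revolution about a coordinate axis, \<open>z(u) a + f(u) w(v)\<close>, where \<open>w\<close>
  traces the unit circle or the unit hyperbola of the plane orthogonal to the axis vector \<open>a\<close>. Since
  \<open>a\<close>, \<open>w\<close> and \<open>w'\<close> are pairwise orthogonal, the induced form is
  \<open>(z'\<^sup>2 B(a,a) + f'\<^sup>2 B(w,w)) du\<^sup>2 + f\<^sup>2 B(w',w') dv\<^sup>2\<close>
  (lemma \<open>pullback_form_revolution\<close>). The height \<open>z\<close> is chosen so that
  the coefficient of \<open>du\<^sup>2\<close> is \<open>1\<close> or \<open>-1\<close>, as required. With \<open>f = cosh\<close> this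
  means \<open>z'\<^sup>2 = 1 + f'\<^sup>2 = cosh\<^sup>2\<close> or \<open>z'\<^sup>2 = 1 - f'\<^sup>2 = 2 - cosh\<^sup>2\<close>, depending on the ambient
  form; with \<open>f = cos\<close> it means \<open>z'\<^sup>2 = 1 - f'\<^sup>2 = cos\<^sup>2\<close> or \<open>z'\<^sup>2 = 1 + f'\<^sup>2 = 1 + sin\<^sup>2\<close>. The
  first alternative is solved by \<open>sinh\<close> or \<open>sin\<close> and gives a quadric, the second one by the
  integral of a square root. The condition \<open>cosh u < \<surd>2\<close> keeps the radicand
  \<open>2 - cosh\<^sup>2 u\<close> positive, so that \<open>z\<close> is smooth.

  Injectivity of the differential need not be checked map by map: a vector killed by the
  differential is orthogonal to everything for the pulled back form, so it vanishes where that form is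
  nondegenerate (lemma \<open>isometric_immersion_onI\<close>). Smoothness follows from closure of \<open>C\<^sup>n\<close> maps
  under sums, products and composition with functions all of whose derivatives are known.\<close>

section \<open>Calculus of \<open>C\<^sup>n\<close> maps\<close>

lemma C_diff_on_cong:
  assumes "open U" "\<And>p. p \<in> U \<Longrightarrow> f p = g p" "C_diff_on n U f"
  shows "C_diff_on n U g"
  using assms(2,3)
proof (induction n arbitrary: f g)
  case 0
  then show ?case by (simp cong: continuous_on_cong)
next
  case (Suc n)
  have d: "(g has_derivative frechet_derivative f (at p)) (at p)" if "p \<in> U" for p
    by (rule has_derivative_transform_within_open[OF _ assms(1) that Suc.prems(1)])
       (use Suc.prems(2) that in \<open>auto simp: frechet_derivative_works\<close>)
  have e: "frechet_derivative f (at p) = frechet_derivative g (at p)" if "p \<in> U" for p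
    using frechet_derivative_at[OF d[OF that]] .
  have "C_diff_on n U (\<lambda>p. frechet_derivative g (at p) X)" for X
    by (rule Suc.IH[of "\<lambda>p. frechet_derivative f (at p) X"]) (use e Suc.prems in auto)
  with d show ?case by (auto simp: differentiable_def)
qed

lemma C_diff_on_SucI:
  assumes "open U" "\<And>p. p \<in> U \<Longrightarrow> (f has_derivative f' p) (at p)"
    "\<And>X. C_diff_on n U (\<lambda>p. f' p X)"
  shows "C_diff_on (Suc n) U f"
proof -
  have "C_diff_on n U (\<lambda>p. frechet_derivative f (at p) X)" for X
    by (rule C_diff_on_cong[OF assms(1) _ assms(3)[of X]])
       (use frechet_derivative_at[OF assms(2)] in simp)
  with assms(2) show ?thesis by (auto simp: differentiable_def)
qed

lemma C_diff_on_SucD: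
  assumes "C_diff_on (Suc n) U f"
  shows "p \<in> U \<Longrightarrow> (f has_derivative frechet_derivative f (at p)) (at p)"
    and "C_diff_on n U (\<lambda>p. frechet_derivative f (at p) X)"
  using assms by (auto simp: frechet_derivative_works)

lemma C_diff_on_Suc_imp:
  "C_diff_on (Suc n) U f \<Longrightarrow> C_diff_on n U f"
proof (induction n arbitrary: f)
  case 0
  then show ?case
    by (auto intro!: continuous_at_imp_continuous_on differentiable_imp_continuous_within)
next
  case (Suc n)
  from Suc.prems show ?case
    by (auto intro: Suc.IH)
qed

lemma C_diff_on_const: "open U \<Longrightarrow> C_diff_on n U (\<lambda>p. c)"
proof (induction n arbitrary: c)
  case (Suc n)
  show ?case
    by (rule C_diff_on_SucI[where f' = "\<lambda>p X. 0"]) (use Suc in auto)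
qed auto

lemma C_diff_on_add:
  assumes "open U" "C_diff_on n U f" "C_diff_on n U g"
  shows "C_diff_on n U (\<lambda>p. f p + g p)"
  using assms(2,3)
proof (induction n arbitrary: f g)
  case 0
  then show ?case by (auto intro: continuous_on_add)
next
  case (Suc n)
  note f = C_diff_on_SucD[OF Suc.prems(1)] and g = C_diff_on_SucD[OF Suc.prems(2)]
  show ?case
    by (rule C_diff_on_SucI[where f' = "\<lambda>p X. frechet_derivative f (at p) X + frechet_derivative g (at p) X"])
       (use assms(1) f g Suc.IH has_derivative_add in auto)
qed

lemma C_diff_on_scaleR:
  fixes f :: "'a::real_normed_vector \<Rightarrow> real"
  assumes "open U" "C_diff_on n U f" "C_diff_on n U g"
  shows "C_diff_on n U (\<lambda>p. f p *\<^sub>R g p)"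
  using assms(2,3)
proof (induction n arbitrary: f g)
  case 0
  then show ?case by (auto intro: continuous_on_scaleR)
next
  case (Suc n)
  note f = C_diff_on_SucD[OF Suc.prems(1)] and g = C_diff_on_SucD[OF Suc.prems(2)]
  have der: "((\<lambda>p. f p *\<^sub>R g p) has_derivative (\<lambda>X. f p *\<^sub>R frechet_derivative g (at p) X
      + frechet_derivative f (at p) X *\<^sub>R g p)) (at p)" if "p \<in> U" for p
    using has_derivative_scaleR[OF f(1)[OF that] g(1)[OF that]] .
  show ?case
    by (rule C_diff_on_SucI[OF assms(1) der], assumption)
       (intro C_diff_on_add Suc.IH f g assms(1) Suc.prems[THEN C_diff_on_Suc_imp])
qed

lemma smooth_on_const: "open U \<Longrightarrow> smooth_on U (\<lambda>p. c)"
  by (simp add: smooth_on_def C_diff_on_const)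

lemma smooth_on_add:
  "open U \<Longrightarrow> smooth_on U f \<Longrightarrow> smooth_on U g \<Longrightarrow> smooth_on U (\<lambda>p. f p + g p)"
  by (simp add: smooth_on_def C_diff_on_add)

lemma smooth_on_scaleR:
  fixes f :: "'a::real_normed_vector \<Rightarrow> real"
  shows "open U \<Longrightarrow> smooth_on U f \<Longrightarrow> smooth_on U g \<Longrightarrow> smooth_on U (\<lambda>p. f p *\<^sub>R g p)"
  by (simp add: smooth_on_def C_diff_on_scaleR)

lemma smooth_on_mult:
  fixes f g :: "'a::real_normed_vector \<Rightarrow> real"
  shows "open U \<Longrightarrow> smooth_on U f \<Longrightarrow> smooth_on U g \<Longrightarrow> smooth_on U (\<lambda>p. f p * g p)"
  using smooth_on_scaleR[of U f g] by simp

text \<open>Integrals need this form: the derivative is known to be smooth, but there is no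
  closed sequence of derivatives.\<close>

lemma smooth_onI:
  assumes "open U" "\<And>p. p \<in> U \<Longrightarrow> (f has_derivative f' p) (at p)"
    "\<And>X. smooth_on U (\<lambda>p. f' p X)"
  shows "smooth_on U f"
  using C_diff_on_SucI[OF assms(1,2)] assms(3) C_diff_on_Suc_imp
  unfolding smooth_on_def by blast

lemma smooth_on_linear:
  assumes "open U" "bounded_linear f"
  shows "smooth_on U f"
  by (rule smooth_onI[OF assms(1) bounded_linear_imp_has_derivative[OF assms(2)]])
     (rule smooth_on_const[OF assms(1)])

text \<open>The whole sequence of derivatives is carried along because differentiating
  \<open>D k \<circ> f\<close> produces \<open>D (Suc k) \<circ> f\<close>, so the induction on the order must range over all \<open>k\<close>.\<close>

lemma smooth_on_compose_derivatives:
  fixes f :: "'a::real_normed_vector \<Rightarrow> real"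
  assumes U: "open U" and f: "smooth_on U f"
    and D: "\<And>k p. p \<in> U \<Longrightarrow> (D k has_real_derivative D (Suc k) (f p)) (at (f p))"
  shows "smooth_on U (\<lambda>p. D k (f p))"
proof -
  have fC: "C_diff_on n U f" for n
    using f by (simp add: smooth_on_def)
  have der: "((\<lambda>p. D k (f p)) has_derivative
      (\<lambda>X. D (Suc k) (f p) * frechet_derivative f (at p) X)) (at p)" if "p \<in> U" for p k
    using diff_chain_at[OF C_diff_on_SucD(1)[OF fC that] D[OF that, unfolded has_field_derivative_def]]
    by (simp add: o_def)
  have "C_diff_on n U (\<lambda>p. D k (f p))" for n k
  proof (induction n arbitrary: k)
    case 0
    show ?case
      by (auto intro!: continuous_at_imp_continuous_on has_derivative_continuous der)
  next
    case (Suc n)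
    show ?case
      by (rule C_diff_on_SucI[OF U der])
         (use C_diff_on_scaleR[OF U Suc C_diff_on_SucD(2)[OF fC]] in auto)
  qed
  then show ?thesis by (simp add: smooth_on_def)
qed

text \<open>The derivatives of the sine are its translates by multiples of \<open>\<pi> / 2\<close>, so that one
  sequence serves for both functions.\<close>

lemma smooth_on_sin_cos:
  fixes f :: "'a::real_normed_vector \<Rightarrow> real"
  assumes "open U" "smooth_on U f"
  shows "smooth_on U (\<lambda>p. sin (f p))" "smooth_on U (\<lambda>p. cos (f p))"
proof -
  have d: "((\<lambda>t. sin (t + real k * pi / 2)) has_real_derivative sin (t + real (Suc k) * pi / 2)) (at t)"
    for k t
  proof -
    have "sin (t + real (Suc k) * pi / 2) = sin ((t + real k * pi / 2) + pi / 2)"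
      by (simp add: field_simps)
    also have "\<dots> = cos (t + real k * pi / 2)"
      by (simp add: sin_add)
    finally show ?thesis by (auto intro!: derivative_eq_intros)
  qed
  note * = smooth_on_compose_derivatives[where D = "\<lambda>k t. sin (t + real k * pi / 2)", OF assms d]
  show "smooth_on U (\<lambda>p. sin (f p))" "smooth_on U (\<lambda>p. cos (f p))"
    using *[of 0] *[of 1] by (simp_all add: sin_add)
qed

lemma smooth_on_sinh_cosh:
  fixes f :: "'a::real_normed_vector \<Rightarrow> real"
  assumes "open U" "smooth_on U f"
  shows "smooth_on U (\<lambda>p. sinh (f p))" "smooth_on U (\<lambda>p. cosh (f p))"
proof -
  have d: "((if even k then sinh else cosh) has_real_derivative (if even (Suc k) then sinh else cosh) t)
      (at t)" for k and t :: real
    by (auto intro!: derivative_eq_intros)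
  note * = smooth_on_compose_derivatives[where D = "\<lambda>k. if even k then sinh else cosh", OF assms d]
  show "smooth_on U (\<lambda>p. sinh (f p))" "smooth_on U (\<lambda>p. cosh (f p))"
    using *[of 0] *[of 1] by simp_all
qed

text \<open>The square root is written as \<open>t powr (1/2)\<close> because its successive derivatives are multiples
  of real powers.\<close>

lemma smooth_on_sqrt:
  fixes f :: "'a::real_normed_vector \<Rightarrow> real"
  assumes "open U" "smooth_on U f" and pos: "\<And>p. p \<in> U \<Longrightarrow> 0 < f p"
  shows "smooth_on U (\<lambda>p. sqrt (f p))"
proof -
  let ?D = "\<lambda>k t. (\<Prod>i<k. 1/2 - real i) * t powr (1/2 - real k)"
  have d: "(?D k has_real_derivative ?D (Suc k) (f p)) (at (f p))" if "p \<in> U" for k p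
    using pos[OF that]
    by (auto intro!: derivative_eq_intros simp: diff_diff_eq add.commute)
  have "smooth_on U (\<lambda>p. ?D 0 (f p))"
    by (rule smooth_on_compose_derivatives[where D = ?D, OF assms(1,2) d])
  then have s: "smooth_on U (\<lambda>p. f p powr (1/2))" by simp
  show ?thesis
    unfolding smooth_on_def
    by (rule allI, rule C_diff_on_cong[OF assms(1) _ s[unfolded smooth_on_def, rule_format]])
       (use pos in \<open>auto simp: powr_half_sqrt less_imp_le\<close>)
qed

lemma vector3_eq_sum_axis:
  "vector [a, b, c] = a *\<^sub>R axis 1 1 + b *\<^sub>R axis 2 1 + c *\<^sub>R (axis 3 1 :: real^3)"
  by (simp add: vec_eq_iff forall_3 axis_def)

lemma smooth_on_vector3:
  assumes "open U" "smooth_on U a" "smooth_on U b" "smooth_on U c"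
  shows "smooth_on U (\<lambda>p. vector [a p, b p, c p] :: real^3)"
  unfolding vector3_eq_sum_axis
  by (intro smooth_on_add smooth_on_scaleR smooth_on_const assms)

lemma has_derivative_vector3:
  assumes "(a has_derivative a') F" "(b has_derivative b') F" "(c has_derivative c') F"
  shows "((\<lambda>p. vector [a p, b p, c p] :: real^3) has_derivative (\<lambda>X. vector [a' X, b' X, c' X])) F"
  unfolding vector3_eq_sum_axis
  by (intro has_derivative_add has_derivative_scaleR_left assms)

lemma smooth_on_nth: "open U \<Longrightarrow> smooth_on U (\<lambda>p::real^'n. p $ i)"
  by (rule smooth_on_linear) (auto intro: bounded_linear_vec_nth)

lemmas smooth_intros =
  smooth_on_const smooth_on_add smooth_on_mult smooth_on_sin_cos smooth_on_sinh_cosh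
  smooth_on_vector3 smooth_on_nth

lemma has_derivative_comp_nth:
  assumes "(h has_real_derivative d) (at (p $ i))"
  shows "((\<lambda>q::real^'n. h (q $ i)) has_derivative (\<lambda>X. d * X $ i)) (at p)"
  using diff_chain_at[OF bounded_linear_imp_has_derivative[OF bounded_linear_vec_nth]
      assms[unfolded has_field_derivative_def]]
  by (simp add: o_def)

text \<open>The base point 0 may lie on either side of \<open>x\<close>, so the fundamental theorem is applied on an
  interval that contains both in its interior.\<close>

lemma DERIV_interval_integral:
  fixes g :: "real \<Rightarrow> real"
  assumes "continuous_on UNIV g"
  shows "((\<lambda>u. LBINT t=0..u. g t) has_real_derivative g x) (at x)"
proof -
  let ?a = "min 0 x - 1" and ?b = "max 0 x + 1"
  have "((\<lambda>u. LBINT t=ereal 0..u. g t) has_vector_derivative g x) (at x within {?a..?b})"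
    by (rule interval_integral_FTC2) (auto intro: continuous_on_subset[OF assms])
  moreover have "at x within {?a..?b} = at x"
    by (rule at_within_interior) auto
  ultimately show ?thesis
    by (simp add: has_real_derivative_iff_has_vector_derivative zero_ereal_def)
qed

lemma smooth_on_interval_integral:
  fixes g :: "real \<Rightarrow> real" and U :: "(real^'n) set"
  assumes "open U" "continuous_on UNIV g" "smooth_on U (\<lambda>p. g (p $ i))"
  shows "smooth_on U (\<lambda>p. LBINT t=0..p $ i. g t)"
  by (rule smooth_onI[OF assms(1) has_derivative_comp_nth[OF DERIV_interval_integral[OF assms(2)]]])
     (intro smooth_on_mult smooth_on_const assms)

section \<open>Gaussian curvature of warped product metrics\<close>

lemma partial_deriv_comp_nth:
  assumes "open U" "p \<in> U" "\<And>q. q \<in> U \<Longrightarrow> f q = h (q $ 1)"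
    "(h has_real_derivative d) (at (p $ 1))"
  shows "partial_deriv i f p = (if i = 1 then d else 0)"
proof -
  have "(f has_derivative (\<lambda>X. d * X $ 1)) (at p)"
    by (rule has_derivative_transform_within_open[OF has_derivative_comp_nth[OF assms(4)] assms(1,2)])
       (simp add: assms(3))
  from frechet_derivative_at[OF this, symmetric] show ?thesis
    by (simp add: partial_deriv_def axis_def)
qed

lemma matrix_inv_unique:
  fixes A :: "real^'n^'n"
  assumes "A ** B = mat 1" "B ** A = mat 1"
  shows "matrix_inv A = B"
proof -
  have "invertible A"
    using assms unfolding invertible_def by blast
  then have "A ** matrix_inv A = mat 1 \<and> matrix_inv A ** A = mat 1"
    unfolding invertible_def matrix_inv_def by (rule someI_ex)
  then show ?thesis
    using assms by (metis matrix_mul_assoc matrix_mul_lid matrix_mul_rid)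
qed

lemma metric_matrix_diag:
  "metric_matrix (diag_metric E G) p =
     (\<chi> i j. if i = j then (if i = 1 then E (p$1) (p$2) else G (p$1) (p$2)) else 0)"
  by (simp add: metric_matrix_def diag_metric_def vec_eq_iff forall_2 axis_def)

lemma matrix_inv_diag2:
  assumes "a \<noteq> 0" "b \<noteq> 0"
  shows "matrix_inv (\<chi> i j. if i = j then (if i = 1 then a else b) else 0 :: real^2^2) =
    (\<chi> i j. if i = j then (if i = 1 then 1 / a else 1 / b) else 0)"
  by (rule matrix_inv_unique)
     (use assms in \<open>simp_all add: matrix_matrix_mult_def vec_eq_iff forall_2 sum_2 mat_def\<close>)

text \<open>Everything is a function of \<open>u\<close> alone. The only nonzero symbols are \<open>\<Gamma>\<^sup>1\<^sub>2\<^sub>2 = - c f f' / e\<close> and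
  \<open>\<Gamma>\<^sup>2\<^sub>1\<^sub>2 = \<Gamma>\<^sup>2\<^sub>2\<^sub>1 = f' / f\<close>. In \<open>R\<^sup>1\<^sub>2\<^sub>1\<^sub>2\<close> the two terms in \<open>f'\<^sup>2\<close> cancel.\<close>

lemma gaussian_curvature_warped:
  fixes f :: "real \<Rightarrow> real"
  assumes I: "open I" and e: "e \<noteq> 0" and c: "c \<noteq> 0"
    and f: "\<And>t. t \<in> I \<Longrightarrow> f t \<noteq> 0"
      "\<And>t. t \<in> I \<Longrightarrow> (f has_real_derivative f1 t) (at t)"
      "\<And>t. t \<in> I \<Longrightarrow> (f1 has_real_derivative f2 t) (at t)"
    and p: "p $ 1 \<in> I"
  shows "gaussian_curvature (diag_metric (\<lambda>u v. e) (\<lambda>u v. c * (f u)\<^sup>2)) p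
    = - f2 (p $ 1) / (e * f (p $ 1))"
proof -
  define g where "g = diag_metric (\<lambda>u v. e) (\<lambda>u v. c * (f u)\<^sup>2)"
  define U where "U = {q::real^2. q $ 1 \<in> I}"
  have U: "open U"
    using open_vimage[OF I, of "\<lambda>q::real^2. q $ 1"] by (simp add: U_def vimage_def continuous_intros)
  have pU: "p \<in> U" using p by (simp add: U_def)
  have M: "metric_matrix g q $ i $ j =
      (if i = j then (if i = 1 then e else c * (f (q $ 1))\<^sup>2) else 0)" for q i j
    by (simp add: g_def metric_matrix_diag)
  have Minv: "matrix_inv (metric_matrix g q) $ i $ j =
      (if i = j then (if i = 1 then 1 / e else 1 / (c * (f (q $ 1))\<^sup>2)) else 0)"
    if "q \<in> U" for q i j
  proof -
    have "c * (f (q $ 1))\<^sup>2 \<noteq> 0" using that c f(1) by (simp add: U_def)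
    then show ?thesis
      by (simp add: g_def metric_matrix_diag matrix_inv_diag2[OF e])
  qed
  have dM: "partial_deriv k (\<lambda>q. metric_matrix g q $ i $ j) q =
      (if k = 1 \<and> i = 2 \<and> j = 2 then 2 * c * f (q $ 1) * f1 (q $ 1) else 0)"
    if "q \<in> U" for q k i j
  proof (cases "i = 2 \<and> j = 2")
    case True
    have "((\<lambda>t. c * (f t)\<^sup>2) has_real_derivative 2 * c * f (q $ 1) * f1 (q $ 1)) (at (q $ 1))"
      using that by (auto intro!: derivative_eq_intros f(2) simp: U_def)
    from partial_deriv_comp_nth[OF U that _ this] True show ?thesis by (simp add: M)
  next
    case False
    have "partial_deriv k (\<lambda>q. metric_matrix g q $ i $ j) q = (if k = 1 then 0 else 0)"
      by (rule partial_deriv_comp_nth[OF U that,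
            where h = "\<lambda>t. if i = j then e else 0"])
         (use False exhaust_2[of i] in \<open>auto simp: M\<close>)
    with False show ?thesis by auto
  qed
  have chr: "christoffel g k i j q =
      (if k = 1 \<and> i = 2 \<and> j = 2 then - c * f (q $ 1) * f1 (q $ 1) / e
       else if k = 2 \<and> i \<noteq> j then f1 (q $ 1) / f (q $ 1) else 0)" if "q \<in> U" for k i j q
    using that c f(1) exhaust_2[of i] exhaust_2[of j] exhaust_2[of k]
    by (auto simp: christoffel_def sum_2 Minv dM U_def field_simps power2_eq_square)
  have d1: "partial_deriv 1 (christoffel g 1 2 2) p
      = - c * (f1 (p $ 1) * f1 (p $ 1) + f (p $ 1) * f2 (p $ 1)) / e"
  proof -
    have "((\<lambda>t. - c * f t * f1 t / e) has_real_derivative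
        - c * (f1 (p $ 1) * f1 (p $ 1) + f (p $ 1) * f2 (p $ 1)) / e) (at (p $ 1))"
      using p e by (auto intro!: derivative_eq_intros f(2,3) simp: field_simps)
    from partial_deriv_comp_nth[OF U pU _ this, of "christoffel g 1 2 2" 1] show ?thesis
      by (simp add: chr)
  qed
  have d2: "partial_deriv 2 (christoffel g 1 1 2) p = 0"
    using partial_deriv_comp_nth[OF U pU, of "christoffel g 1 1 2" "\<lambda>t. 0" 0 2]
    by (simp add: chr)
  have "riemann g 1 2 1 2 p = - c * f (p $ 1) * f2 (p $ 1) / e"
    using e f(1)[OF p] by (simp add: riemann_def sum_2 d1 d2 chr[OF pU] field_simps)
  then show ?thesis
    using e c f(1)[OF p]
    by (simp add: gaussian_curvature_def flip: g_def)
       (simp add: sum_2 M det_2 field_simps power2_eq_square)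
qed

text \<open>The coefficient is passed as \<open>G\<close> together with an equation so that forms such as
  \<open>-((cos u)\<^sup>2)\<close> match syntactically with \<open>c = -1\<close>.\<close>

lemma constant_curvature_warped:
  fixes f :: "real \<Rightarrow> real"
  assumes I: "open I" and U: "U = {q. q $ 1 \<in> I}" and e: "e \<noteq> 0" and c: "c \<noteq> 0"
    and G: "\<And>u. G u = c * (f u)\<^sup>2"
    and f: "\<And>t. t \<in> I \<Longrightarrow> f t \<noteq> 0"
      "\<And>t. (f has_real_derivative f1 t) (at t)"
      "\<And>t. (f1 has_real_derivative - K * e * f t) (at t)"
    and sm: "smooth_on U (\<lambda>p. f (p $ 1))"
  shows "constant_curvature_metric_on U (diag_metric (\<lambda>u v. e) (\<lambda>u v. G u)) K"
proof -
  let ?g = "diag_metric (\<lambda>u v. e) (\<lambda>u v. c * (f u)\<^sup>2)"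
  have oU: "open U"
    using open_vimage[OF I, of "\<lambda>q::real^2. q $ 1"] by (simp add: U vimage_def continuous_intros)
  have "smooth_on U (\<lambda>p. ?g p X Y)" for X Y
    unfolding diag_metric_def power2_eq_square by (intro smooth_intros oU sm)
  moreover have "bilinear (?g p)" for p
    by (auto simp: bilinear_def diag_metric_def algebra_simps intro!: linearI)
  moreover have "?g p X Y = ?g p Y X" for p X Y
    by (simp add: diag_metric_def)
  moreover have "X = 0" if "p \<in> U" "\<forall>Y. ?g p X Y = 0" for p X
    using that(2)[rule_format, of "axis 1 1"] that(2)[rule_format, of "axis 2 1"] e c f(1) that(1)
    by (simp add: diag_metric_def axis_def vec_eq_iff forall_2 U)
  moreover have "gaussian_curvature ?g p = K" if "p \<in> U" for p
  proof -
    from that have p: "p $ 1 \<in> I" by (simp add: U)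
    show ?thesis
      using gaussian_curvature_warped[OF I e c f(1) f(2) f(3) p] f(1)[OF p] e by simp
  qed
  ultimately show ?thesis
    using oU unfolding G by (auto simp: constant_curvature_metric_on_def pseudo_Riemannian_metric_on_def)
qed

section \<open>Isometric immersions and surfaces of revolution\<close>

lemma pullback_form_eq:
  "(f has_derivative f') (at p) \<Longrightarrow> pullback_form B f p X Y = B (f' X) (f' Y)"
  using frechet_derivative_at[of f f' p] by (simp add: pullback_form_def)

text \<open>If \<open>df(X) = 0\<close> then \<open>g(X, Y) = B(df X, df Y) = 0\<close> for all \<open>Y\<close>, so nondegeneracy
  of \<open>g\<close> gives \<open>X = 0\<close>.\<close>

lemma isometric_immersion_onI:
  assumes g: "constant_curvature_metric_on V g K" "U \<subseteq> V"
    and B: "bilinear B" and U: "open U" and sm: "smooth_on U f"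
    and pb: "\<And>p. p \<in> U \<Longrightarrow> pullback_form B f p = g p"
  shows "isometric_immersion_on U g B f"
proof -
  have "inj (frechet_derivative f (at p))" if p: "p \<in> U" for p
  proof -
    have "f differentiable at p"
      using sm[unfolded smooth_on_def, rule_format, of "Suc 0"] p by simp
    then have lin: "linear (frechet_derivative f (at p))"
      by (simp add: linear_frechet_derivative)
    have "X = 0" if "frechet_derivative f (at p) X = 0" for X
    proof -
      have "g p X Y = 0" for Y
        using pb[OF p, symmetric] that by (simp add: pullback_form_def bilinear_lzero[OF B])
      then show ?thesis
        using g p unfolding constant_curvature_metric_on_def pseudo_Riemannian_metric_on_def by blast
    qed
    then show ?thesis
      using linear_injective_0[OF lin] by blast
  qed
  then show ?thesis
    using U sm pb by (simp add: isometric_immersion_on_def immersion_on_def)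
qed

text \<open>The partial derivatives are \<open>z' a + f' w\<close> and \<open>f w'\<close>; by orthogonality all mixed products
  vanish.\<close>

lemma pullback_form_revolution:
  fixes w :: "real \<Rightarrow> real^3"
  assumes B: "bilinear B" and sym: "\<And>x y. B x y = B y x"
    and z: "(z has_real_derivative z1) (at (p $ 1))"
    and f: "(f has_real_derivative f1) (at (p $ 1))"
    and w: "(w has_vector_derivative w1) (at (p $ 2))"
    and orth: "B a (w (p $ 2)) = 0" "B a w1 = 0" "B (w (p $ 2)) w1 = 0"
  shows "pullback_form B (\<lambda>p. z (p $ 1) *\<^sub>R a + f (p $ 1) *\<^sub>R w (p $ 2)) p X Y =
    (z1\<^sup>2 * B a a + f1\<^sup>2 * B (w (p $ 2)) (w (p $ 2))) * X $ 1 * Y $ 1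
    + (f (p $ 1))\<^sup>2 * B w1 w1 * X $ 2 * Y $ 2"
proof -
  have dw: "((\<lambda>q. w (q $ 2)) has_derivative (\<lambda>X. X $ 2 *\<^sub>R w1)) (at p)"
    using diff_chain_at[OF bounded_linear_imp_has_derivative[OF bounded_linear_vec_nth]
      w[unfolded has_vector_derivative_def]]
    by (simp add: o_def)
  have d: "((\<lambda>p. z (p $ 1) *\<^sub>R a + f (p $ 1) *\<^sub>R w (p $ 2)) has_derivative
      (\<lambda>X. (z1 * X $ 1) *\<^sub>R a + (f (p $ 1) *\<^sub>R X $ 2 *\<^sub>R w1 + (f1 * X $ 1) *\<^sub>R w (p $ 2)))) (at p)"
    by (intro has_derivative_add has_derivative_scaleR_left has_derivative_scaleR
        has_derivative_comp_nth z f dw)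
  show ?thesis
    unfolding pullback_form_eq[OF d]
    using orth orth[THEN trans[OF sym]]
    by (simp add: bilinear_ladd[OF B] bilinear_radd[OF B] bilinear_lmul[OF B] bilinear_rmul[OF B]
        algebra_simps power2_eq_square)
qed

lemma bilinear_forms: "bilinear lorentz_form" "bilinear index2_form"
  by (auto simp: bilinear_def lorentz_form_def index2_form_def algebra_simps intro!: linearI)

lemma has_vector_derivative_vector3:
  assumes "(a has_real_derivative a') (at t)" "(b has_real_derivative b') (at t)"
    "(c has_real_derivative c') (at t)"
  shows "((\<lambda>t. vector [a t, b t, c t] :: real^3) has_vector_derivative vector [a', b', c']) (at t)"
proof -
  have "vector [a' * h, b' * h, c' * h] = h *\<^sub>R (vector [a', b', c'] :: real^3)" for h
    by (simp add: vec_eq_iff forall_3)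
  with has_derivative_vector3[OF assms[unfolded has_field_derivative_def]] show ?thesis
    by (simp add: has_vector_derivative_def)
qed

lemma pullback_lorentz_circle:
  assumes "(z has_real_derivative z1) (at (p $ 1))" "(f has_real_derivative f1) (at (p $ 1))"
  shows "pullback_form lorentz_form (param (\<lambda>u v. vector [f u * cos v, f u * sin v, z u])) p X Y =
    (f1\<^sup>2 - z1\<^sup>2) * X $ 1 * Y $ 1 + (f (p $ 1))\<^sup>2 * X $ 2 * Y $ 2"
proof -
  have eq: "param (\<lambda>u v. vector [f u * cos v, f u * sin v, z u]) =
      (\<lambda>p. z (p $ 1) *\<^sub>R vector [0, 0, 1] + f (p $ 1) *\<^sub>R vector [cos (p $ 2), sin (p $ 2), 0])"
    by (simp add: fun_eq_iff param_def vec_eq_iff forall_3)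
  have w: "((\<lambda>v. vector [cos v, sin v, 0]) has_vector_derivative
      (vector [- sin v, cos v, 0] :: real^3)) (at v)" for v
    by (rule has_vector_derivative_vector3) (auto intro!: derivative_eq_intros)
  show ?thesis
    unfolding eq
    by (subst pullback_form_revolution[OF bilinear_forms(1) _ assms w])
       (simp_all add: lorentz_form_def sin_squared_eq flip: power2_eq_square)
qed

lemma pullback_lorentz_hyperbola:
  assumes "(z has_real_derivative z1) (at (p $ 1))" "(f has_real_derivative f1) (at (p $ 1))"
  shows "pullback_form lorentz_form (param (\<lambda>u v. vector [z u, f u * cosh v, f u * sinh v])) p X Y =
    (f1\<^sup>2 + z1\<^sup>2) * X $ 1 * Y $ 1 - (f (p $ 1))\<^sup>2 * X $ 2 * Y $ 2"
proof -
  have eq: "param (\<lambda>u v. vector [z u, f u * cosh v, f u * sinh v]) =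
      (\<lambda>p. z (p $ 1) *\<^sub>R vector [1, 0, 0] + f (p $ 1) *\<^sub>R vector [0, cosh (p $ 2), sinh (p $ 2)])"
    by (simp add: fun_eq_iff param_def vec_eq_iff forall_3)
  have w: "((\<lambda>v. vector [0, cosh v, sinh v]) has_vector_derivative
      (vector [0, sinh v, cosh v] :: real^3)) (at v)" for v
    by (rule has_vector_derivative_vector3) (auto intro!: derivative_eq_intros)
  show ?thesis
    unfolding eq
    by (subst pullback_form_revolution[OF bilinear_forms(1) _ assms w])
       (simp_all add: lorentz_form_def cosh_square_eq flip: power2_eq_square)
qed

lemma pullback_index2_circle:
  assumes "(z has_real_derivative z1) (at (p $ 1))" "(f has_real_derivative f1) (at (p $ 1))"
  shows "pullback_form index2_form (param (\<lambda>u v. vector [z u, f u * cos v, f u * sin v])) p X Y =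
    (z1\<^sup>2 - f1\<^sup>2) * X $ 1 * Y $ 1 - (f (p $ 1))\<^sup>2 * X $ 2 * Y $ 2"
proof -
  have eq: "param (\<lambda>u v. vector [z u, f u * cos v, f u * sin v]) =
      (\<lambda>p. z (p $ 1) *\<^sub>R vector [1, 0, 0] + f (p $ 1) *\<^sub>R vector [0, cos (p $ 2), sin (p $ 2)])"
    by (simp add: fun_eq_iff param_def vec_eq_iff forall_3)
  have w: "((\<lambda>v. vector [0, cos v, sin v]) has_vector_derivative
      (vector [0, - sin v, cos v] :: real^3)) (at v)" for v
    by (rule has_vector_derivative_vector3) (auto intro!: derivative_eq_intros)
  show ?thesis
    unfolding eq
    by (subst pullback_form_revolution[OF bilinear_forms(2) _ assms w])
       (simp_all add: index2_form_def sin_squared_eq flip: power2_eq_square)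
qed

lemma pullback_index2_hyperbola:
  assumes "(z has_real_derivative z1) (at (p $ 1))" "(f has_real_derivative f1) (at (p $ 1))"
  shows "pullback_form index2_form (param (\<lambda>u v. vector [f u * sinh v, f u * cosh v, z u])) p X Y =
    - (f1\<^sup>2 + z1\<^sup>2) * X $ 1 * Y $ 1 + (f (p $ 1))\<^sup>2 * X $ 2 * Y $ 2"
proof -
  have eq: "param (\<lambda>u v. vector [f u * sinh v, f u * cosh v, z u]) =
      (\<lambda>p. z (p $ 1) *\<^sub>R vector [0, 0, 1] + f (p $ 1) *\<^sub>R vector [sinh (p $ 2), cosh (p $ 2), 0])"
    by (simp add: fun_eq_iff param_def vec_eq_iff forall_3)
  have w: "((\<lambda>v. vector [sinh v, cosh v, 0]) has_vector_derivative
      (vector [cosh v, sinh v, 0] :: real^3)) (at v)" for v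
    by (rule has_vector_derivative_vector3) (auto intro!: derivative_eq_intros)
  show ?thesis
    unfolding eq
    by (subst pullback_form_revolution[OF bilinear_forms(2) _ assms w])
       (simp_all add: index2_form_def cosh_square_eq flip: power2_eq_square)
qed

section \<open>The coordinate planes, the profile curves and the metrics\<close>

lemma isometric_immersion_linear:
  assumes g: "constant_curvature_metric_on UNIV g K" and B: "bilinear B"
    and f: "linear f" and pb: "\<And>p X Y. B (f X) (f Y) = g p X Y"
  shows "isometric_immersion_on UNIV g B f"
proof -
  have bl: "bounded_linear f" using f by (simp add: linear_conv_bounded_linear)
  have "pullback_form B f p = g p" for p
    by (simp add: fun_eq_iff pullback_form_eq[OF bounded_linear_imp_has_derivative[OF bl]] pb)
  then show ?thesis
    by (intro isometric_immersion_onI[OF g _ B] smooth_on_linear bl) auto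
qed

lemma open_nth_vimage: "open I \<Longrightarrow> open {p::real^'n. p $ i \<in> I}"
  using open_vimage[of I "\<lambda>p::real^'n. p $ i"] by (simp add: vimage_def continuous_intros)

lemma open_domains: "open cosh_domain" "open cos_strip"
proof -
  have "open (cosh -` {1<..<sqrt 2} :: real set)"
    by (intro open_vimage continuous_intros)
  then show "open cosh_domain" unfolding cosh_domain_def by (rule open_nth_vimage)
  show "open cos_strip" unfolding cos_strip_def by (rule open_nth_vimage[OF open_greaterThanLessThan])
qed

lemma cos_strip_subset: "cos_strip \<subseteq> cos_nonzero"
proof
  fix p assume "p \<in> cos_strip"
  then have "cos (p $ 1) > 0"
    by (intro cos_gt_zero_pi) (auto simp: cos_strip_def)
  then show "p \<in> cos_nonzero" by (simp add: cos_nonzero_def)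
qed

lemma smooth_on_cosh_profile: "smooth_on cosh_domain (\<lambda>p. LBINT t=0..p $ 1. sqrt (2 - (cosh t)\<^sup>2))"
proof (rule smooth_on_interval_integral[OF open_domains(1)])
  have "smooth_on cosh_domain (\<lambda>p. sqrt (2 + (-1) * (cosh (p $ 1) * cosh (p $ 1))))"
  proof (rule smooth_on_sqrt[OF open_domains(1)])
    show "smooth_on cosh_domain (\<lambda>p. 2 + (-1) * (cosh (p $ 1) * cosh (p $ 1)))"
      by (intro smooth_intros open_domains)
    show "0 < 2 + (-1) * (cosh (p $ 1) * cosh (p $ 1))" if "p \<in> cosh_domain" for p
    proof -
      have "(cosh (p $ 1))\<^sup>2 < (sqrt 2)\<^sup>2"
        using that by (intro power_strict_mono) (auto simp: cosh_domain_def)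
      then show ?thesis by (simp add: power2_eq_square)
    qed
  qed
  then show "smooth_on cosh_domain (\<lambda>p. sqrt (2 - (cosh (p $ 1))\<^sup>2))"
    by (simp add: power2_eq_square)
qed (intro continuous_intros)

lemma cosh_domain_sqrt: "p \<in> cosh_domain \<Longrightarrow> (sqrt (2 - (cosh (p $ 1))\<^sup>2))\<^sup>2 = 2 - (cosh (p $ 1))\<^sup>2"
proof -
  assume "p \<in> cosh_domain"
  then have "(cosh (p $ 1))\<^sup>2 \<le> (sqrt 2)\<^sup>2"
    by (intro power_mono) (auto simp: cosh_domain_def)
  then show ?thesis by simp
qed

lemma smooth_on_sin_profile: "smooth_on cos_strip (\<lambda>p. LBINT t=0..p $ 1. sqrt (1 + (sin t)\<^sup>2))"
proof (rule smooth_on_interval_integral[OF open_domains(2)])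
  have "smooth_on cos_strip (\<lambda>p. sqrt (1 + sin (p $ 1) * sin (p $ 1)))"
  proof (rule smooth_on_sqrt[OF open_domains(2)])
    show "smooth_on cos_strip (\<lambda>p. 1 + sin (p $ 1) * sin (p $ 1))"
      by (intro smooth_intros open_domains)
  qed (simp add: add_pos_nonneg)
  then show "smooth_on cos_strip (\<lambda>p. sqrt (1 + (sin (p $ 1))\<^sup>2))"
    by (simp add: power2_eq_square)
qed (intro continuous_intros)

lemma DERIV_cosh_profile:
  "((\<lambda>u. LBINT t=0..u. sqrt (2 - (cosh t)\<^sup>2)) has_real_derivative sqrt (2 - (cosh x)\<^sup>2)) (at x)"
  by (rule DERIV_interval_integral) (intro continuous_intros)

lemma DERIV_sin_profile:
  "((\<lambda>u. LBINT t=0..u. sqrt (1 + (sin t)\<^sup>2)) has_real_derivative sqrt (1 + (sin x)\<^sup>2)) (at x)"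
  by (rule DERIV_interval_integral) (intro continuous_intros)

lemma curvature_flat:
  "constant_curvature_metric_on UNIV (diag_metric (\<lambda>u v. -1) (\<lambda>u v. 1)) 0"
  "constant_curvature_metric_on UNIV (diag_metric (\<lambda>u v. 1) (\<lambda>u v. -1)) 0"
proof -
  show "constant_curvature_metric_on UNIV (diag_metric (\<lambda>u v. -1) (\<lambda>u v. 1)) 0"
    by (rule constant_curvature_warped[where I = UNIV and c = 1 and f = "\<lambda>u. 1" and ?f1.0 = "\<lambda>u. 0"])
       (auto intro: smooth_on_const)
  show "constant_curvature_metric_on UNIV (diag_metric (\<lambda>u v. 1) (\<lambda>u v. -1)) 0"
    by (rule constant_curvature_warped[where I = UNIV and c = "-1" and f = "\<lambda>u. 1" and ?f1.0 = "\<lambda>u. 0"])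
       (auto intro: smooth_on_const)
qed

lemma curvature_cosh:
  "constant_curvature_metric_on UNIV (diag_metric (\<lambda>u v. -1) (\<lambda>u v. (cosh u)\<^sup>2)) 1"
  "constant_curvature_metric_on UNIV (diag_metric (\<lambda>u v. 1) (\<lambda>u v. -((cosh u)\<^sup>2))) (-1)"
proof -
  note sm = smooth_on_sinh_cosh(2)[OF open_UNIV smooth_on_nth[OF open_UNIV]]
  show "constant_curvature_metric_on UNIV (diag_metric (\<lambda>u v. -1) (\<lambda>u v. (cosh u)\<^sup>2)) 1"
    by (rule constant_curvature_warped[where I = UNIV and c = 1 and f = cosh and ?f1.0 = sinh])
       (auto intro!: derivative_eq_intros sm)
  show "constant_curvature_metric_on UNIV (diag_metric (\<lambda>u v. 1) (\<lambda>u v. -((cosh u)\<^sup>2))) (-1)"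
    by (rule constant_curvature_warped[where I = UNIV and c = "-1" and f = cosh and ?f1.0 = sinh])
       (auto intro!: derivative_eq_intros sm)
qed

lemma open_cos_nonzero: "open {u::real. cos u \<noteq> 0}"
  by (intro open_Collect_neq continuous_intros)

lemma curvature_cos:
  "constant_curvature_metric_on cos_nonzero (diag_metric (\<lambda>u v. 1) (\<lambda>u v. -((cos u)\<^sup>2))) 1"
  "constant_curvature_metric_on cos_nonzero (diag_metric (\<lambda>u v. -1) (\<lambda>u v. (cos u)\<^sup>2)) (-1)"
proof -
  have U: "cos_nonzero = {p. p $ 1 \<in> {u. cos u \<noteq> 0}}"
    by (simp add: cos_nonzero_def)
  have oU: "open cos_nonzero"
    unfolding U by (rule open_nth_vimage[OF open_cos_nonzero])
  note sm = smooth_on_sin_cos(2)[OF oU smooth_on_nth[OF oU]]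
  show "constant_curvature_metric_on cos_nonzero (diag_metric (\<lambda>u v. 1) (\<lambda>u v. -((cos u)\<^sup>2))) 1"
    by (rule constant_curvature_warped[OF open_cos_nonzero U, where c = "-1" and f = cos and ?f1.0 = "\<lambda>u. - sin u"])
       (auto intro!: derivative_eq_intros sm)
  show "constant_curvature_metric_on cos_nonzero (diag_metric (\<lambda>u v. -1) (\<lambda>u v. (cos u)\<^sup>2)) (-1)"
    by (rule constant_curvature_warped[OF open_cos_nonzero U, where c = 1 and f = cos and ?f1.0 = "\<lambda>u. - sin u"])
       (auto intro!: derivative_eq_intros sm)
qed

theorem mainTheorem2:
  shows "
    \<comment> \<open>\<open>K = 0\<close>\<close>
    constant_curvature_metric_on UNIV (diag_metric (\<lambda>u v. -1) (\<lambda>u v. 1)) 0 \<and>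
    isometric_immersion_on UNIV (diag_metric (\<lambda>u v. -1) (\<lambda>u v. 1)) lorentz_form
       (param (\<lambda>u v. vector [v, 0, u])) \<and>
    isometric_immersion_on UNIV (diag_metric (\<lambda>u v. -1) (\<lambda>u v. 1)) lorentz_form
       (param (\<lambda>u v. vector [0, v, u])) \<and>
    isometric_immersion_on UNIV (diag_metric (\<lambda>u v. -1) (\<lambda>u v. 1)) index2_form
       (param (\<lambda>u v. vector [v, u, 0])) \<and>
    isometric_immersion_on UNIV (diag_metric (\<lambda>u v. -1) (\<lambda>u v. 1)) index2_form
       (param (\<lambda>u v. vector [v, 0, u])) \<and>
    constant_curvature_metric_on UNIV (diag_metric (\<lambda>\<tau> \<theta>. 1) (\<lambda>\<tau> \<theta>. -1)) 0 \<and>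
    isometric_immersion_on UNIV (diag_metric (\<lambda>\<tau> \<theta>. 1) (\<lambda>\<tau> \<theta>. -1)) lorentz_form
       (param (\<lambda>\<tau> \<theta>. vector [\<tau>, 0, \<theta>])) \<and>
    isometric_immersion_on UNIV (diag_metric (\<lambda>\<tau> \<theta>. 1) (\<lambda>\<tau> \<theta>. -1)) lorentz_form
       (param (\<lambda>\<tau> \<theta>. vector [0, \<tau>, \<theta>])) \<and>
    isometric_immersion_on UNIV (diag_metric (\<lambda>\<tau> \<theta>. 1) (\<lambda>\<tau> \<theta>. -1)) index2_form
       (param (\<lambda>\<tau> \<theta>. vector [\<tau>, \<theta>, 0])) \<and>
    isometric_immersion_on UNIV (diag_metric (\<lambda>\<tau> \<theta>. 1) (\<lambda>\<tau> \<theta>. -1)) index2_form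
       (param (\<lambda>\<tau> \<theta>. vector [\<tau>, 0, \<theta>])) \<and>

    \<comment> \<open>\<open>K = 1\<close>\<close>
    constant_curvature_metric_on UNIV (diag_metric (\<lambda>u v. -1) (\<lambda>u v. (cosh u)\<^sup>2)) 1 \<and>
    isometric_immersion_on UNIV (diag_metric (\<lambda>u v. -1) (\<lambda>u v. (cosh u)\<^sup>2)) lorentz_form
       (param (\<lambda>u v. vector [cosh u * cos v, cosh u * sin v, sinh u])) \<and>
    range (param (\<lambda>u v. vector [cosh u * cos v, cosh u * sin v, sinh u])) \<subseteq> de_Sitter \<and>
    isometric_immersion_on cosh_domain (diag_metric (\<lambda>u v. -1) (\<lambda>u v. (cosh u)\<^sup>2)) index2_form
       (param (\<lambda>u v. vector [cosh u * sinh v, cosh u * cosh v,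
                             LBINT t=0..u. sqrt (2 - (cosh t)\<^sup>2)])) \<and>

    constant_curvature_metric_on cos_nonzero (diag_metric (\<lambda>\<tau> \<theta>. 1) (\<lambda>\<tau> \<theta>. -((cos \<tau>)\<^sup>2))) 1 \<and>
    smooth_on UNIV (param (\<lambda>\<tau> \<theta>. vector [sin \<tau>, cos \<tau> * cosh \<theta>, cos \<tau> * sinh \<theta>])) \<and>
    pullback_form lorentz_form
       (param (\<lambda>\<tau> \<theta>. vector [sin \<tau>, cos \<tau> * cosh \<theta>, cos \<tau> * sinh \<theta>]))
     = diag_metric (\<lambda>\<tau> \<theta>. 1) (\<lambda>\<tau> \<theta>. -((cos \<tau>)\<^sup>2)) \<and>
    isometric_immersion_on cos_nonzero (diag_metric (\<lambda>\<tau> \<theta>. 1) (\<lambda>\<tau> \<theta>. -((cos \<tau>)\<^sup>2))) lorentz_form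
       (param (\<lambda>\<tau> \<theta>. vector [sin \<tau>, cos \<tau> * cosh \<theta>, cos \<tau> * sinh \<theta>])) \<and>
    range (param (\<lambda>\<tau> \<theta>. vector [sin \<tau>, cos \<tau> * cosh \<theta>, cos \<tau> * sinh \<theta>])) \<subseteq> de_Sitter \<and>
    isometric_immersion_on cos_strip (diag_metric (\<lambda>\<tau> \<theta>. 1) (\<lambda>\<tau> \<theta>. -((cos \<tau>)\<^sup>2))) index2_form
       (param (\<lambda>\<tau> \<theta>. vector [LBINT t=0..\<tau>. sqrt (1 + (sin t)\<^sup>2),
                             cos \<tau> * cos \<theta>, cos \<tau> * sin \<theta>])) \<and>

    \<comment> \<open>\<open>K = -1\<close>\<close>
    constant_curvature_metric_on cos_nonzero (diag_metric (\<lambda>u v. -1) (\<lambda>u v. (cos u)\<^sup>2)) (-1) \<and>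
    isometric_immersion_on cos_strip (diag_metric (\<lambda>u v. -1) (\<lambda>u v. (cos u)\<^sup>2)) lorentz_form
       (param (\<lambda>u v. vector [cos u * cos v, cos u * sin v,
                             LBINT t=0..u. sqrt (1 + (sin t)\<^sup>2)])) \<and>
    smooth_on UNIV (param (\<lambda>u v. vector [cos u * sinh v, cos u * cosh v, sin u])) \<and>
    pullback_form index2_form (param (\<lambda>u v. vector [cos u * sinh v, cos u * cosh v, sin u]))
     = diag_metric (\<lambda>u v. -1) (\<lambda>u v. (cos u)\<^sup>2) \<and>
    isometric_immersion_on cos_nonzero (diag_metric (\<lambda>u v. -1) (\<lambda>u v. (cos u)\<^sup>2)) index2_form
       (param (\<lambda>u v. vector [cos u * sinh v, cos u * cosh v, sin u])) \<and>
    range (param (\<lambda>u v. vector [cos u * sinh v, cos u * cosh v, sin u])) \<subseteq> anti_de_Sitter \<and>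

    constant_curvature_metric_on UNIV (diag_metric (\<lambda>\<tau> \<theta>. 1) (\<lambda>\<tau> \<theta>. -((cosh \<tau>)\<^sup>2))) (-1) \<and>
    isometric_immersion_on cosh_domain (diag_metric (\<lambda>\<tau> \<theta>. 1) (\<lambda>\<tau> \<theta>. -((cosh \<tau>)\<^sup>2))) lorentz_form
       (param (\<lambda>\<tau> \<theta>. vector [LBINT t=0..\<tau>. sqrt (2 - (cosh t)\<^sup>2),
                             cosh \<tau> * cosh \<theta>, cosh \<tau> * sinh \<theta>])) \<and>
    isometric_immersion_on UNIV (diag_metric (\<lambda>\<tau> \<theta>. 1) (\<lambda>\<tau> \<theta>. -((cosh \<tau>)\<^sup>2))) index2_form
       (param (\<lambda>\<tau> \<theta>. vector [sinh \<tau>, cosh \<tau> * cos \<theta>, cosh \<tau> * sin \<theta>])) \<and>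
    range (param (\<lambda>\<tau> \<theta>. vector [sinh \<tau>, cosh \<tau> * cos \<theta>, cosh \<tau> * sin \<theta>])) \<subseteq> anti_de_Sitter"
proof -
  note defs = lorentz_form_def index2_form_def
  have hyp: "(sinh has_real_derivative cosh x) (at x)" "(cosh has_real_derivative sinh x) (at x)"
    for x :: real
    by (auto intro!: derivative_eq_intros)

  have flat:
    "isometric_immersion_on UNIV (diag_metric (\<lambda>u v. -1) (\<lambda>u v. 1)) lorentz_form
       (param (\<lambda>u v. vector [v, 0, u]))"
    "isometric_immersion_on UNIV (diag_metric (\<lambda>u v. -1) (\<lambda>u v. 1)) lorentz_form
       (param (\<lambda>u v. vector [0, v, u]))"
    "isometric_immersion_on UNIV (diag_metric (\<lambda>u v. -1) (\<lambda>u v. 1)) index2_form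
       (param (\<lambda>u v. vector [v, u, 0]))"
    "isometric_immersion_on UNIV (diag_metric (\<lambda>u v. -1) (\<lambda>u v. 1)) index2_form
       (param (\<lambda>u v. vector [v, 0, u]))"
    "isometric_immersion_on UNIV (diag_metric (\<lambda>\<tau> \<theta>. 1) (\<lambda>\<tau> \<theta>. -1)) lorentz_form
       (param (\<lambda>\<tau> \<theta>. vector [\<tau>, 0, \<theta>]))"
    "isometric_immersion_on UNIV (diag_metric (\<lambda>\<tau> \<theta>. 1) (\<lambda>\<tau> \<theta>. -1)) lorentz_form
       (param (\<lambda>\<tau> \<theta>. vector [0, \<tau>, \<theta>]))"
    "isometric_immersion_on UNIV (diag_metric (\<lambda>\<tau> \<theta>. 1) (\<lambda>\<tau> \<theta>. -1)) index2_form
       (param (\<lambda>\<tau> \<theta>. vector [\<tau>, \<theta>, 0]))"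
    "isometric_immersion_on UNIV (diag_metric (\<lambda>\<tau> \<theta>. 1) (\<lambda>\<tau> \<theta>. -1)) index2_form
       (param (\<lambda>\<tau> \<theta>. vector [\<tau>, 0, \<theta>]))"
    by (rule isometric_immersion_linear[OF curvature_flat(1) bilinear_forms(1)]
          isometric_immersion_linear[OF curvature_flat(1) bilinear_forms(2)]
          isometric_immersion_linear[OF curvature_flat(2) bilinear_forms(1)]
          isometric_immersion_linear[OF curvature_flat(2) bilinear_forms(2)],
        simp add: linear_iff param_def vec_eq_iff forall_3,
        simp add: param_def diag_metric_def defs)+

  have pull:
    "pullback_form lorentz_form (param (\<lambda>u v. vector [cosh u * cos v, cosh u * sin v, sinh u]))
      = diag_metric (\<lambda>u v. -1) (\<lambda>u v. (cosh u)\<^sup>2)"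
    "pullback_form lorentz_form (param (\<lambda>u v. vector [sin u, cos u * cosh v, cos u * sinh v]))
      = diag_metric (\<lambda>u v. 1) (\<lambda>u v. -((cos u)\<^sup>2))"
    "pullback_form index2_form (param (\<lambda>u v. vector [cos u * sinh v, cos u * cosh v, sin u]))
      = diag_metric (\<lambda>u v. -1) (\<lambda>u v. (cos u)\<^sup>2)"
    "pullback_form index2_form (param (\<lambda>u v. vector [sinh u, cosh u * cos v, cosh u * sin v]))
      = diag_metric (\<lambda>u v. 1) (\<lambda>u v. -((cosh u)\<^sup>2))"
    by (intro ext, rule trans[OF pullback_lorentz_circle] trans[OF pullback_lorentz_hyperbola]
          trans[OF pullback_index2_circle] trans[OF pullback_index2_hyperbola],
        (rule hyp DERIV_sin DERIV_cos)+,
        simp add: diag_metric_def cosh_square_eq algebra_simps)+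

  have profile:
    "p \<in> cosh_domain \<Longrightarrow> pullback_form index2_form (param (\<lambda>u v. vector
        [cosh u * sinh v, cosh u * cosh v, LBINT t=0..u. sqrt (2 - (cosh t)\<^sup>2)])) p
      = diag_metric (\<lambda>u v. -1) (\<lambda>u v. (cosh u)\<^sup>2) p"
    "pullback_form index2_form (param (\<lambda>u v. vector
        [LBINT t=0..u. sqrt (1 + (sin t)\<^sup>2), cos u * cos v, cos u * sin v])) p
      = diag_metric (\<lambda>u v. 1) (\<lambda>u v. -((cos u)\<^sup>2)) p"
    "pullback_form lorentz_form (param (\<lambda>u v. vector
        [cos u * cos v, cos u * sin v, LBINT t=0..u. sqrt (1 + (sin t)\<^sup>2)])) p
      = diag_metric (\<lambda>u v. -1) (\<lambda>u v. (cos u)\<^sup>2) p"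
    "p \<in> cosh_domain \<Longrightarrow> pullback_form lorentz_form (param (\<lambda>u v. vector
        [LBINT t=0..u. sqrt (2 - (cosh t)\<^sup>2), cosh u * cosh v, cosh u * sinh v])) p
      = diag_metric (\<lambda>u v. 1) (\<lambda>u v. -((cosh u)\<^sup>2)) p" for p
    by (intro ext, rule trans[OF pullback_lorentz_circle] trans[OF pullback_lorentz_hyperbola]
          trans[OF pullback_index2_circle] trans[OF pullback_index2_hyperbola],
        (rule DERIV_cosh_profile DERIV_sin_profile DERIV_cos hyp)+,
        simp add: diag_metric_def cosh_domain_sqrt sinh_square_eq)+

  have sm:
    "open U \<Longrightarrow> smooth_on U (param (\<lambda>u v. vector [cosh u * cos v, cosh u * sin v, sinh u]))"
    "open U \<Longrightarrow> smooth_on U (param (\<lambda>u v. vector [sin u, cos u * cosh v, cos u * sinh v]))"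
    "open U \<Longrightarrow> smooth_on U (param (\<lambda>u v. vector [cos u * sinh v, cos u * cosh v, sin u]))"
    "open U \<Longrightarrow> smooth_on U (param (\<lambda>u v. vector [sinh u, cosh u * cos v, cosh u * sin v]))" for U
    unfolding param_def[abs_def] by (intro smooth_intros; assumption)+
  have sm_profile:
    "smooth_on cosh_domain (param (\<lambda>u v. vector
        [cosh u * sinh v, cosh u * cosh v, LBINT t=0..u. sqrt (2 - (cosh t)\<^sup>2)]))"
    "smooth_on cos_strip (param (\<lambda>u v. vector
        [LBINT t=0..u. sqrt (1 + (sin t)\<^sup>2), cos u * cos v, cos u * sin v]))"
    "smooth_on cos_strip (param (\<lambda>u v. vector
        [cos u * cos v, cos u * sin v, LBINT t=0..u. sqrt (1 + (sin t)\<^sup>2)]))"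
    "smooth_on cosh_domain (param (\<lambda>u v. vector
        [LBINT t=0..u. sqrt (2 - (cosh t)\<^sup>2), cosh u * cosh v, cosh u * sinh v]))"
    unfolding param_def[abs_def]
    by (intro smooth_intros smooth_on_cosh_profile smooth_on_sin_profile open_domains)+

  have oc: "open cos_nonzero"
    using curvature_cos(1)
    by (simp add: constant_curvature_metric_on_def pseudo_Riemannian_metric_on_def)

  have ranges:
    "range (param (\<lambda>u v. vector [cosh u * cos v, cosh u * sin v, sinh u])) \<subseteq> de_Sitter"
    "range (param (\<lambda>u v. vector [sin u, cos u * cosh v, cos u * sinh v])) \<subseteq> de_Sitter"
    "range (param (\<lambda>u v. vector [cos u * sinh v, cos u * cosh v, sin u])) \<subseteq> anti_de_Sitter"
    "range (param (\<lambda>u v. vector [sinh u, cosh u * cos v, cosh u * sin v])) \<subseteq> anti_de_Sitter"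
    by (auto simp: param_def de_Sitter_def anti_de_Sitter_def defs sin_squared_eq cosh_square_eq
        power_mult_distrib algebra_simps simp flip: power2_eq_square)

  show ?thesis
    by (intro conjI flat curvature_flat curvature_cosh curvature_cos pull ranges sm open_UNIV
        isometric_immersion_onI[OF curvature_cosh(1) order_refl bilinear_forms(1)]
        isometric_immersion_onI[OF curvature_cosh(2) order_refl bilinear_forms(2)]
        isometric_immersion_onI[OF curvature_cos(1) order_refl bilinear_forms(1)]
        isometric_immersion_onI[OF curvature_cos(2) order_refl bilinear_forms(2)]
        isometric_immersion_onI[OF curvature_cosh(1) subset_UNIV bilinear_forms(2) open_domains(1) sm_profile(1) profile(1)]
        isometric_immersion_onI[OF curvature_cos(1) cos_strip_subset bilinear_forms(2) open_domains(2) sm_profile(2) profile(2)]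
        isometric_immersion_onI[OF curvature_cos(2) cos_strip_subset bilinear_forms(1) open_domains(2) sm_profile(3) profile(3)]
        isometric_immersion_onI[OF curvature_cosh(2) subset_UNIV bilinear_forms(1) open_domains(1) sm_profile(4) profile(4)]
        pull[THEN fun_cong] oc; assumption)
qed

end
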